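(* Let $G$ be a finite nonabelian simple group, and suppose that $G$ contains an element $h$ of order $2$ and an element $g$ such that $\{g,g^h\}$ generates $G$, where $g^h=h^{-1}gh$. Let $\Gamma=\mathrm{Cos}(G,\langle h\rangle,g)$. Then $(\Gamma,G)\in\mathcal{OG}(4)$ and $(\Gamma,G)$ is basic of quasiprimitive type.
   Context: All graphs are finite, simple and undirected. For a group $G$, a proper subgroup $H$ and an element $s\in G$, the coset graph $\mathrm{Cos}(G,H,s)$ is the undirected graph with vertex set $\{Hx\mid x\in G\}$ and with $\{Hx,Hy\}$ an edge if and only if $xy^{-1}\in HsH$ or $yx^{-1}\in HsH$; $G$ acts on it by right multiplication. $\mathcal{OG}(4)$ is the set of pairs $(\Gamma,G)$ where $\Gamma$ is a connected graph of valency $4$ with vertex set $X$, and $G\leq\mathrm{Aut}(\Gamma)$ is transitive on $X$ and on edges, and $\Gamma$ is $G$-oriented: there is a $G$-orbit $\Delta\subset X\times X$, disjoint from $\Delta^*=\{(y,x)\mid (x,y)\in\Delta\}$, such that the edges of $\Gamma$ are exactly the pairs $\{x,y\}$ with $(x,y)\in\Delta$ or $(y,x)\in\Delta$. (For the coset graph, $G\leq\mathrm{Aut}(\Gamma)$ means that the right multiplication action of $G$ is faithful.) A pair $(\Gamma,G)\in\mathcal{OG}(4)$ is basic of quasiprimitive type if $G$ is quasiprimitive on $X$, that is, every nontrivial normal subgroup of $G$ is transitive on $X$. *)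

theory Defs
  imports
    "HOL-Algebra.SimpleGroups"
    "HOL-Algebra.Generated_Groups"
    "HOL-Algebra.Multiplicative_Group"
    "HOL-Algebra.Group_Action"
    "Graph_Theory.Graph_Theory"
begin

text \<open>
  A finite simple undirected graph is a symmetric loopless finite digraph (\<open>pair_graph\<close>);
  each undirected edge is the unordered pair of ends of two opposite arcs.
\<close>

definition uedges :: "'v pair_pre_digraph \<Rightarrow> 'v set set" where
  "uedges \<Gamma> = {{u, v} | u v. (u, v) \<in> parcs \<Gamma>}"

definition graph_aut :: "'v pair_pre_digraph \<Rightarrow> ('v \<Rightarrow> 'v) set" where
  "graph_aut \<Gamma> = {f \<in> Bij (pverts \<Gamma>).
     \<forall>u\<in>pverts \<Gamma>. \<forall>v\<in>pverts \<Gamma>. (f u, f v) \<in> parcs \<Gamma> \<longleftrightarrow> (u, v) \<in> parcs \<Gamma>}"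

text \<open>By symmetry of the arc relation, the out-degree of a vertex is its number of neighbours.\<close>

definition has_valency :: "'v pair_pre_digraph \<Rightarrow> nat \<Rightarrow> bool" where
  "has_valency \<Gamma> k \<longleftrightarrow> (\<forall>v\<in>pverts \<Gamma>. out_degree (with_proj \<Gamma>) v = k)"

definition edge_transitive ::
    "'v pair_pre_digraph \<Rightarrow> ('g, 'm) monoid_scheme \<Rightarrow> ('g \<Rightarrow> 'v \<Rightarrow> 'v) \<Rightarrow> bool" where
  "edge_transitive \<Gamma> G \<phi> \<longleftrightarrow>
     (\<forall>e\<in>uedges \<Gamma>. \<forall>e'\<in>uedges \<Gamma>. \<exists>a\<in>carrier G. \<phi> a ` e = e')"

definition oriented ::
    "'v pair_pre_digraph \<Rightarrow> ('g, 'm) monoid_scheme \<Rightarrow> ('g \<Rightarrow> 'v \<Rightarrow> 'v) \<Rightarrow> bool" where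
  "oriented \<Gamma> G \<phi> \<longleftrightarrow>
     (\<exists>\<Delta> \<in> orbits G (pverts \<Gamma> \<times> pverts \<Gamma>) (\<lambda>a (x, y). (\<phi> a x, \<phi> a y)).
        \<Delta> \<inter> \<Delta>\<inverse> = {} \<and> uedges \<Gamma> = {{x, y} | x y. (x, y) \<in> \<Delta> \<or> (y, x) \<in> \<Delta>})"

text \<open>
  The embedding of \<open>G\<close> in the automorphism group of \<open>\<Gamma>\<close> is recorded as a faithful action
  \<open>\<phi>\<close> of \<open>G\<close> on the vertices by automorphisms.
\<close>

definition OG4 ::
    "'v pair_pre_digraph \<Rightarrow> ('g, 'm) monoid_scheme \<Rightarrow> ('g \<Rightarrow> 'v \<Rightarrow> 'v) \<Rightarrow> bool" where
  "OG4 \<Gamma> G \<phi> \<longleftrightarrow>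
     pair_graph \<Gamma> \<and> Digraph_Component.connected (with_proj \<Gamma>) \<and> has_valency \<Gamma> 4 \<and>
     faithful_action G (pverts \<Gamma>) \<phi> \<and> \<phi> ` carrier G \<subseteq> graph_aut \<Gamma> \<and>
     transitive_action G (pverts \<Gamma>) \<phi> \<and> edge_transitive \<Gamma> G \<phi> \<and> oriented \<Gamma> G \<phi>"

definition quasiprimitive ::
    "('g, 'm) monoid_scheme \<Rightarrow> 'v set \<Rightarrow> ('g \<Rightarrow> 'v \<Rightarrow> 'v) \<Rightarrow> bool" where
  "quasiprimitive G X \<phi> \<longleftrightarrow>
     (\<forall>N. N \<lhd> G \<longrightarrow> N \<noteq> {\<one>\<^bsub>G\<^esub>} \<longrightarrow> transitive_action (G\<lparr>carrier := N\<rparr>) X \<phi>)"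

definition basic_quasiprimitive ::
    "'v pair_pre_digraph \<Rightarrow> ('g, 'm) monoid_scheme \<Rightarrow> ('g \<Rightarrow> 'v \<Rightarrow> 'v) \<Rightarrow> bool" where
  "basic_quasiprimitive \<Gamma> G \<phi> \<longleftrightarrow> OG4 \<Gamma> G \<phi> \<and> quasiprimitive G (pverts \<Gamma>) \<phi>"

definition coset_graph ::
    "('g, 'm) monoid_scheme \<Rightarrow> 'g set \<Rightarrow> 'g \<Rightarrow> 'g set pair_pre_digraph" where
  "coset_graph G H s =
     \<lparr>pverts = rcosets\<^bsub>G\<^esub> H,
      parcs = {(H #>\<^bsub>G\<^esub> x, H #>\<^bsub>G\<^esub> y) | x y. x \<in> carrier G \<and> y \<in> carrier G \<and>
        (x \<otimes>\<^bsub>G\<^esub> inv\<^bsub>G\<^esub> y \<in> (H #>\<^bsub>G\<^esub> s) <#>\<^bsub>G\<^esub> H \<or> y \<otimes>\<^bsub>G\<^esub> inv\<^bsub>G\<^esub> x \<in> (H #>\<^bsub>G\<^esub> s) <#>\<^bsub>G\<^esub> H)}\<rparr>"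

definition right_mult :: "('g, 'm) monoid_scheme \<Rightarrow> 'g set \<Rightarrow> 'g \<Rightarrow> 'g set \<Rightarrow> 'g set" where
  "right_mult G H a = (\<lambda>R \<in> rcosets\<^bsub>G\<^esub> H. R #>\<^bsub>G\<^esub> a)"

text \<open>
  Right multiplication is a right action, while \<open>group_action\<close> asks for a homomorphism into
  the group of bijections under composition. Letting \<open>a\<close> act as right multiplication by its
  inverse gives such a homomorphism with the same permutations, kernel and orbits.
\<close>

definition coset_action :: "('g, 'm) monoid_scheme \<Rightarrow> 'g set \<Rightarrow> 'g \<Rightarrow> 'g set \<Rightarrow> 'g set" where
  "coset_action G H a = right_mult G H (inv\<^bsub>G\<^esub> a)"

lemma (in group) coset_action_image:
  assumes "subgroup N G"
  shows "coset_action G H ` N = right_mult G H ` N"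
proof -
  have "(\<lambda>a. inv a) ` N = N"
  proof (intro equalityI subsetI)
    fix x assume "x \<in> N"
    then have "inv x \<in> N" "x = inv (inv x)"
      using assms by (auto simp: subgroup.m_inv_closed subgroup.mem_carrier)
    then show "x \<in> (\<lambda>a. inv a) ` N" by blast
  qed (use assms in \<open>auto simp: subgroup.m_inv_closed\<close>)
  then show ?thesis
    by (metis (no_types, lifting) coset_action_def image_cong image_image)
qed

end

(* The arcs (Hsx, Hx) of Cos(G, H, s) form one G-orbit. This orbit is disjoint from its reverse
   when sHs misses H, and every vertex lies on 2|H| edges when moreover H and its conjugate by s
   meet trivially; the latter also makes the action faithful. For H = {1, h} and s = g, each
   failure of these conditions makes g commute with h or with g^h, or makes both g and g^h
   involutions. In the first two cases G is abelian. In the third, every element of G conjugates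
   c = g g^h to c or its inverse, so <c> is normal and simplicity again forces G to be abelian.
   Quasiprimitivity is immediate from simplicity. *)
theory Submission
  imports Defs
begin

lemma doubletons_symclosure:
  "{{u, v} | u v. (u, v) \<in> A \<union> A\<inverse>} = (\<lambda>(u, v). {u, v}) ` A"
proof -
  have "{{u, v} | u v. (u, v) \<in> A \<union> A\<inverse>} = {{u, v} | u v. (u, v) \<in> A}"
    by blast
  also have "\<dots> = (\<lambda>(u, v). {u, v}) ` A"
    by (auto simp: image_def)
  finally show ?thesis .
qed

lemma (in group) mult_inv_cancel_left:
  assumes "x \<in> carrier G" "y \<in> carrier G"
  shows "x \<otimes> (inv x \<otimes> y) = y"
  using assms by (simp add: m_assoc[symmetric])

section \<open>Coset graphs with an oriented arc orbit\<close>

text \<open>\<open>not_self_paired\<close> says that \<open>inv s\<close> lies outside the double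
  coset HsH, so that no arc is reversed. \<open>trivial_inter\<close> says that \<open>H\<close>
  meets its conjugate by \<open>s\<close> trivially, which separates neighbours and yields
  faithfulness.\<close>

locale orientable_coset_graph = subgroup H G + group G for H and G (structure) +
  fixes s
  assumes s_carrier [simp]: "s \<in> carrier G"
    and not_self_paired: "a \<in> H \<Longrightarrow> s \<otimes> a \<otimes> s \<notin> H"
    and trivial_inter: "\<lbrakk>a \<in> H; s \<otimes> a \<otimes> inv s \<in> H\<rbrakk> \<Longrightarrow> a = \<one>"
begin

abbreviation "\<Gamma> \<equiv> coset_graph G H s"
abbreviation "\<phi> \<equiv> coset_action G H"

text \<open>This set becomes the orbit \<Delta> that orients the graph. Indexing by the
  representative \<open>x\<close> of the head makes the right multiplication action visible.\<close>

definition coset_arcs :: "('a set \<times> 'a set) set" where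
  "coset_arcs = {(H #> (s \<otimes> x), H #> x) | x. x \<in> carrier G}"

lemma rcos_eq_iff:
  assumes "x \<in> carrier G" "y \<in> carrier G"
  shows "H #> x = H #> y \<longleftrightarrow> x \<otimes> inv y \<in> H"
proof
  assume "H #> x = H #> y"
  then have "x \<in> H #> y"
    using assms(1) rcos_self subgroup_axioms by blast
  then show "x \<otimes> inv y \<in> H"
    using rcos_module_imp[OF is_group assms(2)] by blast
next
  assume "x \<otimes> inv y \<in> H"
  then have "x \<in> H #> y"
    using rcos_module_rev[OF is_group assms(2,1)] by blast
  then show "H #> x = H #> y"
    using assms(2) repr_independence subgroup_axioms by metis
qed

lemma rcos_absorb:
  assumes "a \<in> H" "x \<in> carrier G"
  shows "H #> (a \<otimes> x) = H #> x"
  using assms by (subst rcos_eq_iff) (auto simp: m_assoc)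

lemma rcosetsE:
  assumes "R \<in> rcosets H" obtains x where "x \<in> carrier G" "R = H #> x"
  using assms by (auto simp: RCOSETS_def)

lemma pverts_coset_graph [simp]: "pverts \<Gamma> = rcosets H"
  by (simp add: coset_graph_def)

text \<open>If x times \<open>inv y\<close> equals a s b, then b y represents the coset of
  \<open>y\<close>, and s b y represents the coset of \<open>x\<close> because \<open>H\<close>
  absorbs \<open>a\<close>.\<close>

lemma double_coset_imp_arc:
  assumes "x \<in> carrier G" "y \<in> carrier G" "x \<otimes> inv y \<in> (H #> s) <#> H"
  shows "(H #> x, H #> y) \<in> coset_arcs"
proof -
  obtain a b where ab: "a \<in> H" "b \<in> H" "x \<otimes> inv y = a \<otimes> s \<otimes> b"
    using assms(3) by (auto simp: set_mult_def r_coset_def)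
  have "x = (x \<otimes> inv y) \<otimes> y"
    using assms by (simp add: m_assoc)
  then have "x = a \<otimes> (s \<otimes> (b \<otimes> y))"
    using ab assms by (simp add: m_assoc)
  then have "H #> x = H #> (s \<otimes> (b \<otimes> y))"
    using ab assms by (simp add: rcos_absorb)
  moreover have "H #> y = H #> (b \<otimes> y)"
    using ab assms by (simp add: rcos_absorb)
  moreover have "b \<otimes> y \<in> carrier G"
    using ab assms by simp
  ultimately show ?thesis
    unfolding coset_arcs_def by blast
qed

lemma s_in_double_coset: "s \<in> (H #> s) <#> H"
proof -
  have "s \<in> H #> s"
    by (rule rcos_self[OF s_carrier subgroup_axioms])
  moreover have "\<one> \<in> H"
    by (rule subgroup.one_closed[OF subgroup_axioms])
  moreover have "s \<in> {s \<otimes> \<one>}"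
    by simp
  ultimately show ?thesis
    unfolding set_mult_def by (intro UN_I)
qed

lemma parcs_coset_graph: "parcs \<Gamma> = coset_arcs \<union> coset_arcs\<inverse>"
proof
  show "parcs \<Gamma> \<subseteq> coset_arcs \<union> coset_arcs\<inverse>"
    unfolding coset_graph_def using double_coset_imp_arc by auto
  have "(H #> (s \<otimes> x), H #> x) \<in> parcs \<Gamma> \<and> (H #> x, H #> (s \<otimes> x)) \<in> parcs \<Gamma>"
    if x: "x \<in> carrier G" for x
  proof -
    have arc: "(s \<otimes> x) \<otimes> inv x \<in> (H #> s) <#> H"
      using x s_in_double_coset by (simp add: m_assoc)
    have sx: "s \<otimes> x \<in> carrier G"
      using x by simp
    show ?thesis
      unfolding coset_graph_def pair_pre_digraph.simps mem_Collect_eq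
      by (intro conjI; intro exI conjI; rule refl x sx disjI1[OF arc] disjI2[OF arc])
  qed
  then show "coset_arcs \<union> coset_arcs\<inverse> \<subseteq> parcs \<Gamma>"
    unfolding coset_arcs_def by auto
qed

lemma uedges_coset_graph:
  "uedges \<Gamma> = {{H #> (s \<otimes> x), H #> x} | x. x \<in> carrier G}"
  unfolding uedges_def parcs_coset_graph doubletons_symclosure
  by (simp add: coset_arcs_def Setcompr_eq_image image_image)

text \<open>If an arc were also a reversed arc, comparing the two representatives would give some
  \<open>a\<close> in \<open>H\<close> with s a s in \<open>H\<close>.\<close>

lemma coset_arcs_asym: "coset_arcs \<inter> coset_arcs\<inverse> = {}"
proof -
  have False if xy: "x \<in> carrier G" "y \<in> carrier G"
    and eqs: "H #> (s \<otimes> x) = H #> y" "H #> x = H #> (s \<otimes> y)" for x y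
  proof -
    define a where "a = x \<otimes> inv (s \<otimes> y)"
    have a: "a \<in> H"
      using eqs xy rcos_eq_iff unfolding a_def by simp
    have "x = a \<otimes> (s \<otimes> y)"
      unfolding a_def using xy by (simp add: m_assoc)
    then have "(s \<otimes> x) \<otimes> inv y = s \<otimes> a \<otimes> s"
      using xy a by (simp add: m_assoc)
    moreover have "(s \<otimes> x) \<otimes> inv y \<in> H"
      using eqs xy rcos_eq_iff by simp
    ultimately show False
      using not_self_paired a by simp
  qed
  then show ?thesis
    unfolding coset_arcs_def by auto
qed

text \<open>Membership would put s s into \<open>H\<close>, against \<open>not_self_paired\<close>
  at the identity. This is what excludes loops.\<close>

lemma s_notin: "s \<notin> H"
  using not_self_paired[of \<one>] by auto

lemma pair_graph_coset_graph:
  assumes "finite (carrier G)"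
  shows "pair_graph \<Gamma>"
proof -
  have arcs: "parcs \<Gamma> \<subseteq> (rcosets H) \<times> (rcosets H)"
    unfolding parcs_coset_graph coset_arcs_def
    by (auto intro: rcosetsI[OF subset])
  have "finite (rcosets H)"
    using assms by (simp add: RCOSETS_def)
  moreover from this have "finite (parcs \<Gamma>)"
    using arcs finite_subset by blast
  moreover have "fst e \<noteq> snd e" if "e \<in> parcs \<Gamma>" for e
  proof -
    have "H #> (s \<otimes> x) \<noteq> H #> x" if "x \<in> carrier G" for x
      using that s_notin by (simp add: rcos_eq_iff m_assoc)
    then show ?thesis
      using that unfolding parcs_coset_graph coset_arcs_def by force
  qed
  moreover have "symmetric (with_proj \<Gamma>)"
    by (auto simp: symmetric_def parcs_coset_graph intro!: symI)
  ultimately show ?thesis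
    using arcs by unfold_locales auto
qed

section \<open>Connectedness and valency\<close>

text \<open>A word in the generators is read as a walk: left multiplication of a representative by
  \<open>s\<close> or \<open>inv s\<close> moves along an edge, and by an element of
  \<open>H\<close> stays at the same vertex.\<close>

lemma connected_coset_graph:
  assumes "generate G (insert s H) = carrier G"
  shows "Digraph_Component.connected (with_proj \<Gamma>)"
proof -
  \<comment> \<open>Connectedness means strong connectedness of the symmetric closure, which here
    adds no arcs.\<close>
  let ?M = "mk_symmetric (with_proj \<Gamma>)"
  have parcs: "parcs ?M = parcs \<Gamma>"
    by (auto simp: parcs_mk_symmetric parcs_coset_graph)
  have adj: "(H #> (s \<otimes> x), H #> x) \<in> parcs \<Gamma>" "(H #> x, H #> (s \<otimes> x)) \<in> parcs \<Gamma>"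
    if "x \<in> carrier G" for x
    using that unfolding parcs_coset_graph coset_arcs_def by auto
  have step: "(H #> (k \<otimes> x), H #> x) \<in> (parcs \<Gamma>)\<^sup>*"
    if "k \<in> generate G (insert s H)" "x \<in> carrier G" for k x
    using that
  proof (induction k arbitrary: x rule: generate.induct)
    case one
    then show ?case by simp
  next
    case (incl k)
    then show ?case
      using adj by (auto simp: rcos_absorb)
  next
    case (inv k)
    show ?case
    proof (cases "k = s")
      case True
      then show ?thesis
        using adj(2)[of "inv s \<otimes> x"] inv by (simp add: m_assoc[symmetric])
    next
      case False
      then show ?thesis
        using inv by (simp add: rcos_absorb)
    qed
  next
    \<comment> \<open>The walks for \<open>k\<close> and \<open>l\<close> are joined at the coset of
      l x, which is why the induction leaves \<open>x\<close> arbitrary.\<close>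
    case (eng k l)
    have "k \<in> carrier G" "l \<in> carrier G"
      using eng assms by auto
    then show ?case
      using eng.IH(1)[of "l \<otimes> x"] eng.IH(2)[of x] eng.prems by (simp add: m_assoc)
  qed
  have reach: "(H #> x, H #> y) \<in> (parcs \<Gamma>)\<^sup>*" if "x \<in> carrier G" "y \<in> carrier G" for x y
    using step[of "x \<otimes> inv y" y] that assms by (simp add: m_assoc)
  interpret M: pair_wf_digraph ?M
    by unfold_locales
      (auto simp: parcs parcs_coset_graph coset_arcs_def intro!: rcosetsI[OF subset])
  have "u \<rightarrow>\<^sup>*\<^bsub>with_proj ?M\<^esub> v" if "u \<in> rcosets H" "v \<in> rcosets H" for u v
    using that reach by (auto simp: M.reachable_conv' parcs elim!: rcosetsE)
  moreover have "rcosets H \<noteq> {}"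
    by (auto simp: RCOSETS_def)
  ultimately show ?thesis
    unfolding connected_def strongly_connected_def by simp
qed

text \<open>As \<open>a\<close> runs through \<open>H\<close>, a x runs through all representatives
  of the vertex. The label \<open>s\<close> gives the tails of arcs into it, and
  \<open>inv s\<close> the heads of arcs out of it.\<close>

lemma neighbours_coset_graph:
  assumes "x \<in> carrier G"
  shows "{v. (H #> x, v) \<in> parcs \<Gamma>} = (\<lambda>(t, a). H #> (t \<otimes> a \<otimes> x)) ` ({s, inv s} \<times> H)"
    (is "?L = ?R")
proof (intro equalityI subsetI)
  fix v assume "v \<in> ?L"
  then consider y where "y \<in> carrier G" "H #> x = H #> (s \<otimes> y)" "v = H #> y"
    | y where "y \<in> carrier G" "H #> x = H #> y" "v = H #> (s \<otimes> y)"
    unfolding parcs_coset_graph coset_arcs_def by blast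
  then show "v \<in> ?R"
  proof cases
    case 1
    define a where "a = (s \<otimes> y) \<otimes> inv x"
    have "a \<in> H"
      unfolding a_def using 1 assms rcos_eq_iff[of "s \<otimes> y" x] by simp
    moreover have "inv s \<otimes> a \<otimes> x = inv s \<otimes> (s \<otimes> y \<otimes> (inv x \<otimes> x))"
      unfolding a_def using 1 assms by (simp add: m_assoc del: l_inv)
    then have "inv s \<otimes> a \<otimes> x = y"
      using 1 assms by (simp add: m_assoc[symmetric])
    ultimately show ?thesis
      using 1 by force
  next
    case 2
    define a where "a = y \<otimes> inv x"
    have "a \<in> H"
      unfolding a_def using 2 assms rcos_eq_iff[of y x] by simp
    moreover have "s \<otimes> a \<otimes> x = s \<otimes> y"
      unfolding a_def using 2 assms by (simp add: m_assoc)
    ultimately show ?thesis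
      using 2 by force
  qed
next
  fix v assume "v \<in> ?R"
  then obtain a where a: "a \<in> H"
    and v: "v = H #> (s \<otimes> a \<otimes> x) \<or> v = H #> (inv s \<otimes> a \<otimes> x)" by auto
  have "(H #> (a \<otimes> x), H #> (s \<otimes> (a \<otimes> x))) \<in> coset_arcs\<inverse>"
    using a assms unfolding coset_arcs_def by auto
  moreover have "(H #> (s \<otimes> (inv s \<otimes> a \<otimes> x)), H #> (inv s \<otimes> a \<otimes> x)) \<in> coset_arcs"
  proof -
    have "inv s \<otimes> a \<otimes> x \<in> carrier G"
      using a assms by simp
    then show ?thesis
      unfolding coset_arcs_def by blast
  qed
  moreover have "s \<otimes> (inv s \<otimes> a \<otimes> x) = a \<otimes> x"
    using a assms by (simp add: m_assoc[symmetric])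
  ultimately show "v \<in> ?L"
    using v a assms by (auto simp: parcs_coset_graph rcos_absorb m_assoc)
qed

text \<open>The labelling of neighbours by pairs from {s, inv s} and \<open>H\<close> is injective,
  so counting labels counts neighbours.\<close>

lemma coset_graph_valency: "has_valency \<Gamma> (2 * card H)"
proof -
  have inv_ne: "s \<noteq> inv s"
  proof
    assume "s = inv s"
    then have "s \<otimes> s = \<one>"
      using r_inv[OF s_carrier] by simp
    then show False
      using not_self_paired[of \<one>] by simp
  qed
  \<comment> \<open>Two labels giving the same coset differ by an element of this form, with c the
    quotient of their \<open>H\<close>-parts. Equal signs are settled by
    \<open>trivial_inter\<close>, opposite signs by \<open>not_self_paired\<close>, possibly after
    inversion.\<close>
  have key: "t = t' \<and> c = \<one>"
    if t: "t \<in> {s, inv s}" "t' \<in> {s, inv s}" and c: "c \<in> H" and mem: "t \<otimes> c \<otimes> inv t' \<in> H"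
    for t t' c
  proof -
    consider "t = s" "t' = s" | "t = s" "t' = inv s" | "t = inv s" "t' = s"
      | "t = inv s" "t' = inv s" using t by blast
    then show ?thesis
    proof cases
      case 1 then show ?thesis using c mem trivial_inter by simp
    next
      case 2 then show ?thesis using c mem not_self_paired by simp
    next
      case 3
      have "inv (inv s \<otimes> c \<otimes> inv s) = s \<otimes> inv c \<otimes> s"
        using c by (simp add: inv_mult_group m_assoc)
      then show ?thesis
        using 3 mem c not_self_paired[of "inv c"] m_inv_closed by metis
    next
      case 4
      \<comment> \<open>Here the conjugation goes the wrong way for \<open>trivial_inter\<close>, so
        it is applied to the conjugate \<open>d\<close>, whose own conjugate by \<open>s\<close> is
        \<open>c\<close>.\<close>
      define d where "d = inv s \<otimes> c \<otimes> s"
      have d: "d \<in> H" using 4 mem by (simp add: d_def)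
      have sd: "s \<otimes> d \<otimes> inv s = c"
        unfolding d_def using c by (simp add: m_assoc mult_inv_cancel_left)
      then have "d = \<one>"
        using trivial_inter d c by simp
      then show ?thesis using sd 4 by simp
    qed
  qed
  have "out_degree (with_proj \<Gamma>) R = 2 * card H" if "R \<in> rcosets H" for R
  proof -
    obtain x where x: "x \<in> carrier G" and R: "R = H #> x"
      using \<open>R \<in> rcosets H\<close> by (rule rcosetsE)
    let ?f = "\<lambda>(t, a). H #> (t \<otimes> a \<otimes> x)"
    have "inj_on ?f ({s, inv s} \<times> H)"
    proof (rule inj_onI, clarify)
      fix t a t' a'
      assume t: "t \<in> {s, inv s}" "t' \<in> {s, inv s}" and a: "a \<in> H" "a' \<in> H"
        and eq: "H #> (t \<otimes> a \<otimes> x) = H #> (t' \<otimes> a' \<otimes> x)"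
      have tc: "t \<in> carrier G" "t' \<in> carrier G" using t by auto
      have "(t \<otimes> a \<otimes> x) \<otimes> inv (t' \<otimes> a' \<otimes> x) = t \<otimes> (a \<otimes> inv a') \<otimes> inv t'"
        using tc a x by (simp add: inv_mult_group m_assoc mult_inv_cancel_left)
      then have "t \<otimes> (a \<otimes> inv a') \<otimes> inv t' \<in> H"
        using eq tc a x rcos_eq_iff by simp
      then have "t = t'" "a \<otimes> inv a' = \<one>"
        using key[OF t] a by auto
      moreover from this have "a = a'"
        using a by (metis inv_equality inv_inv mem_carrier inv_closed)
      ultimately show "t = t' \<and> a = a'" by simp
    qed
    then have "card {v. (R, v) \<in> parcs \<Gamma>} = 2 * card H"
      unfolding R neighbours_coset_graph[OF x]
      using inv_ne by (simp add: card_image card_cartesian_product)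
    moreover have "out_arcs (with_proj \<Gamma>) R = Pair R ` {v. (R, v) \<in> parcs \<Gamma>}"
      by (auto simp: out_arcs_def)
    ultimately show ?thesis
      by (simp add: out_degree_def card_image inj_on_def)
  qed
  then show ?thesis
    by (simp add: has_valency_def)
qed

section \<open>The right multiplication action\<close>

lemma coset_action_rcos [simp]:
  assumes "a \<in> carrier G" "x \<in> carrier G"
  shows "\<phi> a (H #> x) = H #> (x \<otimes> inv a)"
  using assms rcosetsI[OF subset]
  by (simp add: coset_action_def right_mult_def coset_mult_assoc subset)

lemma coset_action_Bij:
  assumes "a \<in> carrier G"
  shows "\<phi> a \<in> Bij (rcosets H)"
proof -
  have "bij_betw (\<phi> a) (rcosets H) (rcosets H)"
    by (rule bij_betw_byWitness[where f' = "\<phi> (inv a)"])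
      (use assms in \<open>auto elim!: rcosetsE simp: m_assoc intro!: rcosetsI[OF subset]\<close>)
  then show ?thesis
    by (simp add: Bij_def coset_action_def right_mult_def)
qed

lemma coset_group_action: "group_action G (rcosets H) \<phi>"
proof -
  have "\<phi> (a \<otimes> b) = compose (rcosets H) (\<phi> a) (\<phi> b)"
    if "a \<in> carrier G" "b \<in> carrier G" for a b
  proof (rule extensionalityI[where A = "rcosets H"])
    fix R assume "R \<in> rcosets H"
    then show "\<phi> (a \<otimes> b) R = compose (rcosets H) (\<phi> a) (\<phi> b) R"
      using that by (auto elim!: rcosetsE simp: compose_eq inv_mult_group m_assoc
          intro!: rcosetsI[OF subset])
  qed (simp_all add: coset_action_def right_mult_def compose_def)
  then have "\<phi> \<in> hom G (BijGroup (rcosets H))"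
    by (auto simp: hom_def BijGroup_def coset_action_Bij)
  then show ?thesis
    by (simp add: group_action_def group_hom_def group_hom_axioms_def is_group group_BijGroup)
qed

lemma coset_transitive_action: "transitive_action G (rcosets H) \<phi>"
proof -
  have "\<exists>a\<in>carrier G. \<phi> a R = S" if R: "R \<in> rcosets H" and S: "S \<in> rcosets H" for R S
  proof -
    obtain x where x: "x \<in> carrier G" "R = H #> x"
      using R by (rule rcosetsE)
    obtain y where y: "y \<in> carrier G" "S = H #> y"
      using S by (rule rcosetsE)
    note xy = x y
    \<comment> \<open>The action multiplies by the inverse, here \<open>inv x\<close> times
      \<open>y\<close>, which turns the representative \<open>x\<close> into
      \<open>y\<close>.\<close>
    have "\<phi> (inv y \<otimes> x) R = S"
      using xy by (simp add: inv_mult_group m_assoc[symmetric])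
    then show ?thesis
      using xy by blast
  qed
  then show ?thesis
    by (simp add: transitive_action_def transitive_action_axioms_def coset_group_action)
qed

text \<open>A kernel element fixes the cosets of \<open>\<one>\<close> and of \<open>s\<close>.
  Hence its inverse and the conjugate of that inverse by \<open>s\<close> both lie in
  \<open>H\<close>, where \<open>trivial_inter\<close> applies.\<close>

lemma coset_faithful_action: "faithful_action G (rcosets H) \<phi>"
proof -
  interpret action: group_action G "rcosets H" \<phi>
    by (rule coset_group_action)
  interpret hom: group_hom G "BijGroup (rcosets H)" \<phi>
    by (rule action.group_hom)
  have "a = \<one>" if a: "a \<in> carrier G" and ker: "\<phi> a = \<one>\<^bsub>BijGroup (rcosets H)\<^esub>" for a
  proof -
    have fix_rcos: "H #> (x \<otimes> inv a) = H #> x" if "x \<in> carrier G" for x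
      using coset_action_rcos[OF a that] ker that rcosetsI[OF subset that]
      by (simp add: BijGroup_def)
    have "inv a \<in> H"
      using fix_rcos[of \<one>] a by (simp add: rcos_eq_iff)
    moreover have "s \<otimes> inv a \<otimes> inv s \<in> H"
      using fix_rcos[of s] a by (simp add: rcos_eq_iff)
    ultimately have "inv a = \<one>"
      by (rule trivial_inter)
    then show ?thesis
      using a by (metis inv_inv inv_one)
  qed
  then have "inj_on \<phi> (carrier G)"
    using hom.inj_on_one_iff by blast
  then show ?thesis
    by (simp add: faithful_action_def faithful_action_axioms_def coset_group_action)
qed

lemma coset_action_arcs:
  assumes "a \<in> carrier G" "(u, v) \<in> parcs \<Gamma>"
  shows "(\<phi> a u, \<phi> a v) \<in> parcs \<Gamma>"
proof -
  have "(\<phi> a u, \<phi> a v) \<in> coset_arcs" if "(u, v) \<in> coset_arcs" for u v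
    using that assms(1) unfolding coset_arcs_def by (auto simp: m_assoc)
  then show ?thesis
    using assms(2) unfolding parcs_coset_graph by auto
qed

text \<open>Arcs are preserved by every group element; applying this to the inverse element shows
  that they are reflected as well.\<close>

lemma coset_action_aut: "\<phi> ` carrier G \<subseteq> graph_aut \<Gamma>"
proof -
  interpret action: group_action G "rcosets H" \<phi>
    by (rule coset_group_action)
  have "(u, v) \<in> parcs \<Gamma>"
    if "a \<in> carrier G" "u \<in> rcosets H" "v \<in> rcosets H" "(\<phi> a u, \<phi> a v) \<in> parcs \<Gamma>" for a u v
  proof -
    have "\<phi> (inv a) (\<phi> a u) = u" "\<phi> (inv a) (\<phi> a v) = v"
      by (rule action.orbit_sym_aux[OF that(1) _ refl], rule that)+
    then show ?thesis
      using coset_action_arcs[OF inv_closed[OF that(1)] that(4)] by simp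
  qed
  then have "(\<phi> a u, \<phi> a v) \<in> parcs \<Gamma> \<longleftrightarrow> (u, v) \<in> parcs \<Gamma>"
    if "a \<in> carrier G" "u \<in> rcosets H" "v \<in> rcosets H" for a u v
    using that coset_action_arcs[OF that(1)] by metis
  then show ?thesis
    unfolding graph_aut_def pverts_coset_graph using coset_action_Bij
    by (intro image_subsetI CollectI conjI ballI) simp_all
qed

lemma coset_edge_transitive: "edge_transitive \<Gamma> G \<phi>"
proof -
  have "\<exists>a\<in>carrier G. \<phi> a ` {H #> (s \<otimes> x), H #> x} = {H #> (s \<otimes> y), H #> y}"
    if "x \<in> carrier G" "y \<in> carrier G" for x y
  proof -
    have "x \<otimes> inv (inv y \<otimes> x) = y"
      using that by (simp add: inv_mult_group m_assoc[symmetric])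
    \<comment> \<open>One element carries both ends, since right multiplication commutes with left
      multiplication by \<open>s\<close>.\<close>
    then have "\<phi> (inv y \<otimes> x) ` {H #> (s \<otimes> x), H #> x} = {H #> (s \<otimes> y), H #> y}"
      using that by (simp add: m_assoc)
    then show ?thesis
      using that by blast
  qed
  then show ?thesis
    unfolding edge_transitive_def uedges_coset_graph by blast
qed

text \<open>The orbit of the base arc from the coset of \<open>s\<close> to \<open>H\<close> is all
  of \<open>coset_arcs\<close>, which is already known to be disjoint from its converse.\<close>

lemma coset_oriented: "oriented \<Gamma> G \<phi>"
proof -
  let ?\<psi> = "\<lambda>a (u, v). (\<phi> a u, \<phi> a v)"
  have arcs: "Group_Action.orbit G ?\<psi> (H #> s, H #> \<one>) = coset_arcs"
  proof -
    have "Group_Action.orbit G ?\<psi> (H #> s, H #> \<one>)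
        = (\<lambda>a. (H #> (s \<otimes> inv a), H #> inv a)) ` carrier G"
      by (simp add: Group_Action.orbit_def Setcompr_eq_image cong: image_cong)
    also have "\<dots> = (\<lambda>x. (H #> (s \<otimes> x), H #> x)) ` (\<lambda>a. inv a) ` carrier G"
      by (simp add: image_image)
    \<comment> \<open>Reindexing by inversion removes the inverse built into
      \<open>coset_action\<close>.\<close>
    also have "(\<lambda>a. inv a) ` carrier G = carrier G"
    proof (intro equalityI subsetI)
      fix x assume "x \<in> carrier G"
      then show "x \<in> (\<lambda>a. inv a) ` carrier G"
        by (intro image_eqI[of x _ "inv x"]) simp_all
    qed auto
    finally show ?thesis
      by (simp add: coset_arcs_def Setcompr_eq_image)
  qed
  have "(H #> s, H #> \<one>) \<in> pverts \<Gamma> \<times> pverts \<Gamma>"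
    using rcosetsI[OF subset s_carrier] rcosetsI[OF subset one_closed] by simp
  then have "coset_arcs \<in> orbits G (pverts \<Gamma> \<times> pverts \<Gamma>) ?\<psi>"
    unfolding orbits_def by (intro CollectI exI conjI) (rule arcs[symmetric])
  moreover have "uedges \<Gamma> = {{x, y} | x y. (x, y) \<in> coset_arcs \<or> (y, x) \<in> coset_arcs}"
    by (simp only: uedges_def parcs_coset_graph Un_iff converse_iff)
  ultimately show ?thesis
    unfolding oriented_def by (intro bexI[of _ coset_arcs] conjI coset_arcs_asym)
qed

lemma OG4_coset_graph:
  assumes "finite (carrier G)" "card H = 2" "generate G (insert s H) = carrier G"
  shows "OG4 \<Gamma> G \<phi>"
  using assms pair_graph_coset_graph connected_coset_graph coset_graph_valency
    coset_faithful_action coset_action_aut coset_transitive_action coset_edge_transitive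
    coset_oriented
  by (simp add: OG4_def)

end

section \<open>Commutativity criteria and simplicity\<close>

lemma (in group) comm_group_if_generators_commute:
  assumes "generate G S = carrier G" "S \<subseteq> carrier G"
    and comm: "\<And>x y. \<lbrakk>x \<in> S; y \<in> S\<rbrakk> \<Longrightarrow> x \<otimes> y = y \<otimes> x"
  shows "comm_group G"
proof -
  have inv_comm: "inv x \<otimes> y = y \<otimes> inv x"
    if "x \<in> carrier G" "y \<in> carrier G" "x \<otimes> y = y \<otimes> x" for x y
    using that by (metis inv_closed inv_solve_left inv_solve_right m_assoc m_closed)
  have extend: "x \<otimes> y = y \<otimes> x"
    if "y \<in> carrier G" "\<And>z. z \<in> S \<Longrightarrow> z \<otimes> y = y \<otimes> z" "x \<in> generate G S" for x y
    using that(3)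
  proof (induction rule: generate.induct)
    case (eng k l)
    then show ?case
      using assms(1) that(1) by (metis m_assoc)
  qed (use that assms(2) inv_comm in auto)
  \<comment> \<open>\<open>extend\<close> is used twice: first to show that a generator commutes
    with everything, then, with that as its hypothesis, for an arbitrary fixed element.\<close>
  have "x \<otimes> y = y \<otimes> x" if "x \<in> S" "y \<in> carrier G" for x y
    using extend[of x y] comm that assms by auto
  then have "x \<otimes> y = y \<otimes> x" if "x \<in> carrier G" "y \<in> carrier G" for x y
    using extend[of y x] that assms(1) by auto
  then show ?thesis
    by (simp add: group_comm_groupI)
qed

text \<open>Two involutions generate a dihedral-type group, in which the cyclic subgroup generated
  by their product is normal.\<close>

lemma (in simple_group) comm_group_if_generated_by_involutions:
  assumes a: "a \<in> carrier G" "a \<otimes> a = \<one>" and b: "b \<in> carrier G" "b \<otimes> b = \<one>"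
    and gen: "generate G {a, b} = carrier G"
  shows "comm_group G"
proof -
  define c where "c = a \<otimes> b"
  have c: "c \<in> carrier G" using a b by (simp add: c_def)
  have inv_ab: "inv a = a" "inv b = b"
    using a b by (simp_all add: inv_equality)
  have inv_c: "inv c = b \<otimes> a"
    using a b by (simp add: c_def inv_mult_group inv_ab)
  have conj: "x \<otimes> c \<otimes> inv x \<in> {c, inv c}" if "x \<in> generate G {a, b}" for x
    using that
  proof (induction rule: generate.induct)
    case one
    then show ?case using c by simp
  next
    \<comment> \<open>Both involutions conjugate \<open>c\<close> to b a, which is
      \<open>inv c\<close>.\<close>
    have "a \<otimes> c \<otimes> inv a = (a \<otimes> a) \<otimes> b \<otimes> a" "b \<otimes> c \<otimes> inv b = b \<otimes> a \<otimes> (b \<otimes> b)"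
      unfolding c_def inv_ab using a(1) b(1) by (simp_all add: m_assoc)
    then have *: "k \<otimes> c \<otimes> inv k \<in> {c, inv c}" if "k \<in> {a, b}" for k
      using that a b unfolding inv_c by auto
    {
      case (incl k)
      then show ?case by (rule *)
    next
      case (inv k)
      then have "inv k = k" using inv_ab by blast
      then show ?case using *[OF inv] by simp
    }
  next
    case (eng k l)
    have kl: "k \<in> carrier G" "l \<in> carrier G" using eng gen by auto
    have "k \<otimes> inv c \<otimes> inv k = inv (k \<otimes> c \<otimes> inv k)"
      using kl c by (simp add: inv_mult_group m_assoc)
    \<comment> \<open>Conjugation by \<open>l\<close> may already have inverted \<open>c\<close>, so
      the conjugate of \<open>inv c\<close> by \<open>k\<close> is needed too.\<close>
    then have "k \<otimes> inv c \<otimes> inv k \<in> {c, inv c}"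
      using eng.IH(1) c by auto
    moreover have "(k \<otimes> l) \<otimes> c \<otimes> inv (k \<otimes> l) = k \<otimes> (l \<otimes> c \<otimes> inv l) \<otimes> inv k"
      using kl c by (simp add: inv_mult_group m_assoc)
    ultimately show ?case
      using eng.IH by auto
  qed
  have "generate G {c, inv c} \<lhd> G"
  proof (rule normal_generateI)
    fix h x assume h: "h \<in> {c, inv c}" and x: "x \<in> carrier G"
    have "x \<otimes> inv c \<otimes> inv x = inv (x \<otimes> c \<otimes> inv x)"
      using x c by (simp add: inv_mult_group m_assoc)
    then show "x \<otimes> h \<otimes> inv x \<in> {c, inv c}"
      using conj[of x] h x c gen by auto
  qed (use c in auto)
  then consider "generate G {c, inv c} = carrier G" | "generate G {c, inv c} = {\<one>}"
    using no_real_normal_subgroup by blast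
  then show ?thesis
  \<comment> \<open>Either \<open>G\<close> is generated by \<open>c\<close> and its inverse, which
    commute, or \<open>c\<close> is trivial, so that \<open>a = b\<close> and \<open>G\<close> has a
    single generator.\<close>
  proof cases
    case 1
    show ?thesis
      by (rule comm_group_if_generators_commute[OF 1]) (use c in auto)
  next
    case 2
    have "c = \<one>" using generate.incl[of c "{c, inv c}" G] 2 by simp
    then have "a = b"
      using a b inv_ab unfolding c_def by (metis inv_equality)
    show ?thesis
      by (rule comm_group_if_generators_commute[OF gen]) (use a \<open>a = b\<close> in auto)
  qed
qed

lemma (in simple_group) transitive_imp_quasiprimitive:
  assumes "transitive_action G X \<phi>"
  shows "quasiprimitive G X \<phi>"
proof -
  have "G\<lparr>carrier := carrier G\<rparr> = G" by simp
  then show ?thesis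
    using assms no_real_normal_subgroup unfolding quasiprimitive_def by metis
qed

section \<open>Verification for an involution and a generating conjugate pair\<close>

theorem lemma5p2:
  fixes G :: "('g, 'm) monoid_scheme" (structure) and g h :: 'g
  assumes "simple_group G" and "finite (carrier G)" and "\<not> comm_group G"
    and "h \<in> carrier G" and "group.ord G h = 2"
    and "g \<in> carrier G" and "generate G {g, inv h \<otimes> g \<otimes> h} = carrier G"
  defines "H \<equiv> generate G {h}"
  shows "OG4 (coset_graph G H g) G (coset_action G H)
    \<and> basic_quasiprimitive (coset_graph G H g) G (coset_action G H)"
proof -
  interpret simple_group G by fact
  note [simp] = \<open>h \<in> carrier G\<close> \<open>g \<in> carrier G\<close>
  have hh: "h \<otimes> h = \<one>"
    using pow_ord_eq_1[of h] assms(5) by (simp add: numeral_2_eq_2)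
  have inv_h: "inv h = h"
    using hh by (simp add: inv_equality)
  have h1: "h \<noteq> \<one>"
    using assms(5) by auto
  have sub: "subgroup H G"
    unfolding H_def by (rule generate_is_subgroup) simp
  have H: "H = {\<one>, h}"
  proof
    show "H \<subseteq> {\<one>, h}"
      unfolding H_def
      by (rule generate_subgroup_incl) (auto simp: hh inv_h intro!: subgroupI)
    show "{\<one>, h} \<subseteq> H"
      unfolding H_def by (auto intro: generate.intros)
  qed
  have gen: "generate G {g, h \<otimes> g \<otimes> h} = carrier G"
    using assms(7) inv_h by simp
  \<comment> \<open>Since \<open>h\<close> is its own inverse, h g h is the conjugate of
    \<open>g\<close> by \<open>h\<close>; commuting generators would make \<open>G\<close>
    abelian.\<close>
  have conj_ne: "h \<otimes> g \<otimes> h \<otimes> g \<noteq> g \<otimes> (h \<otimes> g \<otimes> h)"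
  proof
    assume eq: "h \<otimes> g \<otimes> h \<otimes> g = g \<otimes> (h \<otimes> g \<otimes> h)"
    have "comm_group G"
    proof (rule comm_group_if_generators_commute[OF gen])
      fix x y assume "x \<in> {g, h \<otimes> g \<otimes> h}" "y \<in> {g, h \<otimes> g \<otimes> h}"
      then show "x \<otimes> y = y \<otimes> x"
        using eq by (elim insertE emptyE) (simp_all only:)
    qed simp
    then show False
      using assms(3) by simp
  qed
  have nc: "h \<otimes> g \<noteq> g \<otimes> h"
  proof
    assume "h \<otimes> g = g \<otimes> h"
    then have "h \<otimes> g \<otimes> h = g"
      by (simp add: m_assoc hh)
    then show False
      using conj_ne by simp
  qed
  have gg: "g \<otimes> g \<noteq> \<one>"
  proof
    assume gg: "g \<otimes> g = \<one>"
    have "(h \<otimes> g \<otimes> h) \<otimes> (h \<otimes> g \<otimes> h) = h \<otimes> g \<otimes> (h \<otimes> h) \<otimes> g \<otimes> h"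
      by (simp add: m_assoc)
    also have "\<dots> = h \<otimes> (g \<otimes> g) \<otimes> h"
      unfolding hh by (simp add: m_assoc)
    finally have "(h \<otimes> g \<otimes> h) \<otimes> (h \<otimes> g \<otimes> h) = \<one>"
      using gg hh by simp
    then show False
      using comm_group_if_generated_by_involutions[OF _ gg _ _ gen] assms(3) by simp
  qed
  \<comment> \<open>Otherwise \<open>h\<close> would be a power of \<open>g\<close> and commute with
    it.\<close>
  have ggh: "g \<otimes> g \<noteq> h"
    using nc m_assoc[of g g g] by auto
  \<comment> \<open>The equation would make \<open>inv g\<close> equal to both g h and h g.\<close>
  have ghg: "g \<otimes> h \<otimes> g \<noteq> \<one>"
  proof
    assume eq: "g \<otimes> h \<otimes> g = \<one>"
    then have "inv g = g \<otimes> h"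
      by (simp add: inv_equality)
    moreover have "inv (h \<otimes> g) = g"
      using eq by (simp add: inv_equality m_assoc)
    then have "inv g = h \<otimes> g"
      by (metis inv_inv m_closed \<open>h \<in> carrier G\<close> \<open>g \<in> carrier G\<close>)
    ultimately show False
      using nc by simp
  qed
  \<comment> \<open>The equation would make both products of \<open>g\<close> with its conjugate
    equal to h h.\<close>
  have ghgh: "g \<otimes> h \<otimes> g \<noteq> h"
  proof
    assume *: "g \<otimes> h \<otimes> g = h"
    have "g \<otimes> (h \<otimes> g \<otimes> h) = (g \<otimes> h \<otimes> g) \<otimes> h" "h \<otimes> g \<otimes> h \<otimes> g = h \<otimes> (g \<otimes> h \<otimes> g)"
      by (simp_all add: m_assoc)
    then show False
      using conj_ne * by simp
  qed
  have "(g \<otimes> h \<otimes> inv g) \<otimes> g = g \<otimes> h"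
    by (simp add: m_assoc)
  \<comment> \<open>If the conjugate were \<open>\<one>\<close>, then \<open>h\<close> would be
    \<open>\<one>\<close>; if it were \<open>h\<close>, then \<open>g\<close> and \<open>h\<close>
    would commute.\<close>
  then have ghi: "g \<otimes> h \<otimes> inv g \<noteq> \<one>" "g \<otimes> h \<otimes> inv g \<noteq> h"
    using nc h1 by auto
  interpret orientable_coset_graph H G g
  proof (intro orientable_coset_graph.intro orientable_coset_graph_axioms.intro sub is_group)
    show "g \<otimes> a \<otimes> g \<notin> H" if "a \<in> H" for a
      \<comment> \<open>With \<open>a\<close> and the target both ranging over {\<one>, h}, these
        four facts are exactly the four cases.\<close>
      using that gg ggh ghg ghgh unfolding H by auto
    show "a = \<one>" if "a \<in> H" "g \<otimes> a \<otimes> inv g \<in> H" for a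
      using that ghi unfolding H by auto
  qed simp
  have in_gen: "g \<in> generate G (insert g H)" "h \<in> generate G (insert g H)"
    using H by (auto intro: generate.incl)
  \<comment> \<open>Adjoining \<open>H\<close> to \<open>g\<close> recovers the conjugate h g h,
    hence the given generating pair, as connectedness requires.\<close>
  have "generate G {g, h \<otimes> g \<otimes> h} \<subseteq> generate G (insert g H)"
  proof (rule generate_subgroup_incl)
    show "subgroup (generate G (insert g H)) G"
      using subset by (intro generate_is_subgroup) simp
    show "{g, h \<otimes> g \<otimes> h} \<subseteq> generate G (insert g H)"
      using in_gen by (simp add: generate.eng)
  qed
  then have "generate G (insert g H) = carrier G"
    using gen generate_incl[of "insert g H"] subset by simp
  then have "OG4 (coset_graph G H g) G (coset_action G H)"
    using assms(2) H h1 by (intro OG4_coset_graph) simp_all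
  then show ?thesis
    using transitive_imp_quasiprimitive[OF coset_transitive_action]
    by (simp add: basic_quasiprimitive_def)
qed

end
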